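(* Among all rooted trees with $n$ vertices, the rooted path $P_n$ uniquely maximises the level spectral radius. Moreover, $$\rho_L(P_n)=\frac{1}{\cosh(t)-1},$$ where $t>0$ satisfies $$\tanh(t/2)\,\tanh(n\cdot t/2)=\frac1n.$$
   Context: A rooted tree is a finite tree with a distinguished vertex (the root). The level $l(v)$ of a vertex $v$ is its distance from the root. For a rooted tree $T$ with vertices $v_1,\dots,v_n$, the level matrix $L(T)=(l_{ij})$ is the $n\times n$ real symmetric matrix with $l_{ij}=|l(v_i)-l(v_j)|$. The level spectral radius $\rho_L(T)$ is the largest absolute value of an eigenvalue of $L(T)$. The rooted path $P_n$ is the $n$-vertex path rooted at one of its endvertices. *)

theory Defs
  imports
    "Graph_Theory.Pair_Digraph"
    "Graph_Theory.Digraph_Component"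
    "Graph_Theory.Digraph_Isomorphism"
    "Jordan_Normal_Form.Spectral_Radius"
begin

text \<open>
  Simple graphs are represented as symmetric loop-free digraphs (\<open>pair_graph\<close>), each edge
  being a pair of opposite arcs. The library predicate \<open>Digraph_Component.tree\<close> is not usable
  here: in a symmetric digraph an edge traversed back and forth counts as a \<open>cycle\<close>. A cycle
  of the underlying simple graph is a \<open>cycle\<close> of length at least 3. Connectedness includes
  that the vertex set is nonempty.
\<close>

definition undirected_tree :: "'a pair_pre_digraph \<Rightarrow> bool" where
  "undirected_tree G \<longleftrightarrow>
     pair_graph G \<and> Digraph_Component.connected (with_proj G) \<and>
     \<not> (\<exists>p. pre_digraph.cycle (with_proj G) p \<and> 3 \<le> length p)"

definition rooted_tree :: "'a pair_pre_digraph \<Rightarrow> 'a \<Rightarrow> bool" where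
  "rooted_tree G r \<longleftrightarrow> undirected_tree G \<and> r \<in> pverts G"

definition level :: "'a pair_pre_digraph \<Rightarrow> 'a \<Rightarrow> 'a \<Rightarrow> nat" where
  "level G r v = (LEAST k. \<exists>p. pre_digraph.awalk (with_proj G) r p v \<and> length p = k)"

definition level_matrix :: "'a pair_pre_digraph \<Rightarrow> 'a \<Rightarrow> 'a list \<Rightarrow> real mat" where
  "level_matrix G r vs = mat (length vs) (length vs)
     (\<lambda>(i, j). \<bar>real (level G r (vs ! i)) - real (level G r (vs ! j))\<bar>)"

text \<open>
  The level matrix depends on a numbering \<open>vs\<close> of the vertices, its spectral radius does not;
  see \<open>level_spectral_radius_eq\<close> below.
\<close>

definition level_spectral_radius :: "'a pair_pre_digraph \<Rightarrow> 'a \<Rightarrow> real" where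
  "level_spectral_radius G r = spectral_radius (map_mat complex_of_real
     (level_matrix G r (SOME vs. distinct vs \<and> set vs = pverts G)))"

definition path_graph :: "nat \<Rightarrow> nat pair_pre_digraph" where
  "path_graph n = \<lparr> pverts = {..<n},
     parcs = {(i, j). i < n \<and> j < n \<and> (j = Suc i \<or> i = Suc j)} \<rparr>"

definition rooted_iso ::
  "'a pair_pre_digraph \<Rightarrow> 'a \<Rightarrow> 'b pair_pre_digraph \<Rightarrow> 'b \<Rightarrow> bool" where
  "rooted_iso G r H s \<longleftrightarrow>
     (\<exists>f. pre_digraph.digraph_isomorphism (with_proj G) f \<and>
          with_proj H = app_iso f (with_proj G) \<and> iso_verts f r = s)"

lemma rooted_iso_iff_bij:
  assumes "pair_wf_digraph G" "pair_wf_digraph H"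
  shows "rooted_iso G r H s \<longleftrightarrow>
    (\<exists>h. bij_betw h (pverts G) (pverts H) \<and> h r = s \<and>
       (\<forall>u\<in>pverts G. \<forall>v\<in>pverts G. (u, v) \<in> parcs G \<longleftrightarrow> (h u, h v) \<in> parcs H))"
  (is "_ \<longleftrightarrow> (\<exists>h. ?P h)")
proof
  interpret G: pair_wf_digraph G by fact
  assume "rooted_iso G r H s"
  then obtain f where f: "pre_digraph.digraph_isomorphism (with_proj G) f"
    and H: "with_proj H = app_iso f (with_proj G)" and r: "iso_verts f r = s"
    unfolding rooted_iso_def by blast
  have V: "pverts H = iso_verts f ` pverts G" and A: "parcs H = iso_arcs f ` parcs G"
    and "iso_tail f = fst" "iso_head f = snd"
    using H by (auto simp: with_proj_def app_iso_def)
  then have ends: "iso_arcs f a = (iso_verts f (fst a), iso_verts f (snd a))" if "a \<in> parcs G" for a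
    using f that unfolding pre_digraph.digraph_isomorphism_def by (auto simp: prod_eq_iff)
  have inj: "inj_on (iso_verts f) (pverts G)"
    using f unfolding pre_digraph.digraph_isomorphism_def by simp
  have "(u, v) \<in> parcs G \<longleftrightarrow> (iso_verts f u, iso_verts f v) \<in> parcs H"
    if uv: "u \<in> pverts G" "v \<in> pverts G" for u v
  proof
    assume "(u, v) \<in> parcs G"
    then show "(iso_verts f u, iso_verts f v) \<in> parcs H"
      using ends[of "(u, v)"] unfolding A by force
  next
    assume "(iso_verts f u, iso_verts f v) \<in> parcs H"
    then obtain a where a: "a \<in> parcs G" "(iso_verts f u, iso_verts f v) = iso_arcs f a"
      unfolding A by blast
    then have "iso_verts f u = iso_verts f (fst a)" "iso_verts f v = iso_verts f (snd a)"
      using ends by auto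
    then have "u = fst a" "v = snd a"
      using inj uv G.arc_fst_in_verts[OF a(1)] G.arc_snd_in_verts[OF a(1)]
      by (auto dest: inj_onD)
    with a show "(u, v) \<in> parcs G" by simp
  qed
  then show "\<exists>h. ?P h"
    using V inj r by (intro exI[of _ "iso_verts f"]) (auto simp: bij_betw_def)
next
  interpret G: pair_wf_digraph G by fact
  interpret H: pair_wf_digraph H by fact
  assume "\<exists>h. ?P h"
  then obtain h where h: "bij_betw h (pverts G) (pverts H)" "h r = s"
    and arcs: "\<And>u v. u \<in> pverts G \<Longrightarrow> v \<in> pverts G \<Longrightarrow> (u, v) \<in> parcs G \<longleftrightarrow> (h u, h v) \<in> parcs H"
    by blast
  have inj: "inj_on h (pverts G)" and V: "h ` pverts G = pverts H"
    using h by (auto simp: bij_betw_def)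
  have sub: "parcs G \<subseteq> pverts G \<times> pverts G"
    using G.arc_fst_in_verts G.arc_snd_in_verts by force
  define f where "f = \<lparr> iso_verts = h, iso_arcs = map_prod h h, iso_head = snd, iso_tail = fst \<rparr>"
  have "inj_on (map_prod h h) (parcs G)"
    using map_prod_inj_on[OF inj inj] sub by (rule inj_on_subset)
  then have "pre_digraph.digraph_isomorphism (with_proj G) f"
    unfolding pre_digraph.digraph_isomorphism_def f_def
    using inj G.wf_digraph by simp
  moreover have "parcs H = map_prod h h ` parcs G"
  proof (intro equalityI subsetI)
    fix a assume a: "a \<in> parcs H"
    then obtain u v where "u \<in> pverts G" "v \<in> pverts G" "a = (h u, h v)"
      using H.arc_fst_in_verts[OF a] H.arc_snd_in_verts[OF a] unfolding V[symmetric]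
      by (metis imageE prod.collapse)
    with a arcs show "a \<in> map_prod h h ` parcs G" by force
  next
    fix a assume "a \<in> map_prod h h ` parcs G"
    with sub arcs show "a \<in> parcs H" by auto
  qed
  then have "with_proj H = app_iso f (with_proj G)"
    by (simp add: with_proj_def app_iso_def f_def V)
  ultimately show "rooted_iso G r H s"
    unfolding rooted_iso_def using h(2) by (intro exI[of _ f]) (simp add: f_def)
qed

lemma spectrum_level_matrix_subset:
  assumes "distinct vs" "distinct ws" "set vs = set ws"
  shows "spectrum (map_mat complex_of_real (level_matrix G r vs))
    \<subseteq> spectrum (map_mat complex_of_real (level_matrix G r ws))"
proof
  let ?n = "length vs"
  let ?A = "\<lambda>us. map_mat complex_of_real (level_matrix G r us)"
  let ?l = "\<lambda>x y. complex_of_real \<bar>real (level G r x) - real (level G r y)\<bar>"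
  have n: "length ws = ?n" using assms by (metis distinct_card)
  define q where "q x = (THE i. i < ?n \<and> vs ! i = x)" for x
  have q_vs: "q (vs ! i) = i" if "i < ?n" for i
    unfolding q_def using that assms(1) by (auto simp: nth_eq_iff_index_eq)
  have q: "q x < ?n \<and> vs ! q x = x" if "x \<in> set vs" for x
    using that q_vs by (metis in_set_conv_nth)
  fix k assume "k \<in> spectrum (?A vs)"
  then obtain v where v: "v \<in> carrier_vec ?n" "v \<noteq> 0\<^sub>v ?n" "?A vs *\<^sub>v v = k \<cdot>\<^sub>v v"
    by (auto simp: spectrum_def eigenvalue_def eigenvector_def level_matrix_def)
  define w where "w = vec ?n (\<lambda>i. v $ q (ws ! i))"
  have ws_in: "ws ! i \<in> set vs" if "i < ?n" for i
    using that n assms(3) by (metis nth_mem)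
  have bij: "bij_betw (\<lambda>i. q (ws ! i)) {0..<?n} {0..<?n}"
  proof -
    have "inj_on (\<lambda>i. q (ws ! i)) {0..<?n}"
      using q ws_in n assms(2) by (intro inj_onI) (metis atLeastLessThan_iff nth_eq_iff_index_eq)
    moreover have "(\<lambda>i. q (ws ! i)) ` {0..<?n} \<subseteq> {0..<?n}" using q ws_in by auto
    ultimately show ?thesis by (simp add: bij_betw_def endo_inj_surj)
  qed
  have "w \<noteq> 0\<^sub>v ?n"
  proof
    assume w0: "w = 0\<^sub>v ?n"
    have "v $ j = 0" if j: "j < ?n" for j
    proof -
      obtain i where "i < ?n" "q (ws ! i) = j"
        using bij j unfolding bij_betw_def by (metis (no_types, lifting) atLeastLessThan_iff imageE zero_le)
      then show ?thesis using arg_cong[OF w0, of "\<lambda>u. u $ i"] by (simp add: w_def)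
    qed
    then show False using v by auto
  qed
  moreover have "?A ws *\<^sub>v w = k \<cdot>\<^sub>v w"
  proof (rule eq_vecI)
    fix i assume "i < dim_vec (k \<cdot>\<^sub>v w)"
    then have i: "i < ?n" by (simp add: w_def)
    let ?i = "q (ws ! i)"
    have i': "?i < ?n" "vs ! ?i = ws ! i" using q ws_in i by auto
    have "(?A ws *\<^sub>v w) $ i = (\<Sum>j\<in>{0..<?n}. ?l (ws ! i) (ws ! j) * v $ q (ws ! j))"
      using i n by (simp add: level_matrix_def w_def scalar_prod_def)
    also have "\<dots> = (\<Sum>j\<in>{0..<?n}. ?l (vs ! ?i) (vs ! q (ws ! j)) * v $ q (ws ! j))"
      using q ws_in i' by (intro sum.cong) auto
    also have "\<dots> = (\<Sum>j\<in>{0..<?n}. ?l (vs ! ?i) (vs ! j) * v $ j)"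
      by (rule sum.reindex_bij_betw[OF bij, of "\<lambda>j. ?l (vs ! ?i) (vs ! j) * v $ j"])
    also have "\<dots> = (?A vs *\<^sub>v v) $ ?i"
      using i' v(1) by (simp add: level_matrix_def scalar_prod_def)
    also have "\<dots> = (k \<cdot>\<^sub>v w) $ i" using v i i' by (simp add: w_def)
    finally show "(?A ws *\<^sub>v w) $ i = (k \<cdot>\<^sub>v w) $ i" .
  qed (simp add: level_matrix_def w_def n)
  ultimately show "k \<in> spectrum (?A ws)"
    by (auto simp: spectrum_def eigenvalue_def eigenvector_def level_matrix_def n
        intro!: exI[of _ w]) (simp_all add: w_def)
qed

lemma level_spectral_radius_eq:
  assumes "distinct vs" "set vs = pverts G"
  shows "level_spectral_radius G r
    = spectral_radius (map_mat complex_of_real (level_matrix G r vs))"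
proof -
  let ?us = "SOME vs. distinct vs \<and> set vs = pverts G"
  have "distinct ?us \<and> set ?us = pverts G" using assms by (intro someI) auto
  then have "spectrum (map_mat complex_of_real (level_matrix G r ?us))
      = spectrum (map_mat complex_of_real (level_matrix G r vs))"
    using assms by (intro equalityI spectrum_level_matrix_subset) auto
  then show ?thesis by (simp add: level_spectral_radius_def spectral_radius_def)
qed

end

theory Submission
  imports Defs
begin

text \<open>
  Number the vertices of a rooted tree by nondecreasing level, \<open>l 0 \<le> l 1 \<le> \<dots>\<close>. Every vertex
  other than the root has a neighbour exactly one level below it, so no level is skipped: \<open>l 0 = 0\<close>
  and \<open>l (i + 1) \<le> l i + 1\<close> (\<open>sorted_enumeration\<close>). Hence \<open>\<bar>l i - l j\<bar> \<le> \<bar>i - j\<bar>\<close>: in this numbering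
  the level matrix is dominated entrywise by the level matrix \<open>D = (\<bar>i - j\<bar>)\<close> of the path.

  Because \<open>D\<close> is symmetric, a positive eigenvector \<open>v\<close> replaces Perron--Frobenius theory. If
  \<open>0 \<le> A \<le> D\<close> and \<open>A x = k x\<close>, then \<open>y = \<bar>x\<bar>\<close> satisfies \<open>\<bar>k\<bar> y \<le> A y \<le> D y\<close>; pairing with \<open>v\<close>
  gives \<open>\<bar>k\<bar> \<le> ev\<close>, where \<open>D v = ev v\<close>. In the case of equality \<open>A y = D y = ev y\<close>, the positive
  off-diagonal entries of \<open>D\<close> make \<open>y\<close> positive everywhere, and so \<open>A = D\<close>
  (\<open>spectral_radius_less\<close>).

  The eigenvector is explicit (\<open>perron_kernel_path\<close>). The second difference of \<open>i \<mapsto> \<bar>i - j\<bar>\<close> is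
  twice the unit vector at \<open>j\<close>, so an eigenvector for \<open>ev\<close> must satisfy
  \<open>ev (v (i + 1) - 2 v i + v (i - 1)) = 2 v i\<close>; the symmetric solution is
  \<open>v i = cosh (t (i - (n - 1) / 2))\<close> with \<open>ev = 1 / (cosh t - 1)\<close>, and the boundary terms cancel
  exactly when \<open>tanh (t / 2) tanh (n t / 2) = 1 / n\<close>.

  For uniqueness, \<open>A = D\<close> means \<open>l i = i\<close>, that is, the level function is a bijection onto
  \<open>{..<n}\<close>. That bijection is then an isomorphism onto the path: arcs join vertices whose
  levels differ by exactly one, and consecutive levels are joined since every vertex but the root has
  a neighbour below it (\<open>bij_level_rooted_iso_path\<close>). Conversely, an isomorphism
  onto the path satisfies the characterisation of the level function (\<open>level_eqI\<close>), so it is the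
  level function.
\<close>

section \<open>Nonnegative symmetric kernels with a positive eigenvector\<close>

text \<open>The witness is the vector of absolute values of an eigenvector for \<open>k\<close>; the inequality is
  the triangle inequality.\<close>
lemma eigenvalue_abs_le_abs_kernel:
  fixes a :: "nat \<Rightarrow> nat \<Rightarrow> real"
  assumes nonneg: "\<And>i j. i < n \<Longrightarrow> j < n \<Longrightarrow> 0 \<le> a i j"
    and k: "k \<in> spectrum (map_mat complex_of_real (mat n n (\<lambda>(i, j). a i j)))"
  shows "\<exists>y :: nat \<Rightarrow> real. (\<forall>i. 0 \<le> y i) \<and> (\<exists>i<n. 0 < y i) \<and>
    (\<forall>i<n. norm k * y i \<le> (\<Sum>j<n. a i j * y j))"
proof -
  let ?A = "map_mat complex_of_real (mat n n (\<lambda>(i, j). a i j))"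
  obtain x where x: "x \<in> carrier_vec n" "x \<noteq> 0\<^sub>v n" "?A *\<^sub>v x = k \<cdot>\<^sub>v x"
    using k by (auto simp: spectrum_def eigenvalue_def eigenvector_def)
  have row: "k * x $ i = (\<Sum>j<n. complex_of_real (a i j) * x $ j)" if i: "i < n" for i
  proof -
    have "k * x $ i = (?A *\<^sub>v x) $ i" using x i by simp
    also have "\<dots> = (\<Sum>j<n. complex_of_real (a i j) * x $ j)"
      using x(1) i by (simp add: scalar_prod_def atLeast0LessThan)
    finally show ?thesis .
  qed
  have "\<exists>i<n. 0 < norm (x $ i)"
  proof (rule ccontr)
    assume "\<not> ?thesis"
    with x(1) have "x = 0\<^sub>v n" by (intro eq_vecI) auto
    with x(2) show False by simp
  qed
  moreover have "norm k * norm (x $ i) \<le> (\<Sum>j<n. a i j * norm (x $ j))" if i: "i < n" for i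
  proof -
    have "norm k * norm (x $ i) \<le> (\<Sum>j<n. norm (complex_of_real (a i j) * x $ j))"
      unfolding norm_mult[symmetric] row[OF i] by (rule norm_sum)
    also have "\<dots> = (\<Sum>j<n. a i j * norm (x $ j))"
      using nonneg i by (intro sum.cong) (auto simp: norm_mult)
    finally show ?thesis .
  qed
  ultimately show ?thesis by (intro exI[of _ "\<lambda>i. norm (x $ i)"]) auto
qed

text \<open>The eigenvalue of a positive eigenvector is automatically the spectral radius; see
  \<open>spectral_radius_eq\<close>.\<close>
locale perron_kernel =
  fixes n :: nat and d :: "nat \<Rightarrow> nat \<Rightarrow> real" and v :: "nat \<Rightarrow> real" and ev :: real
  assumes n: "0 < n"
    and sym: "\<And>i j. i < n \<Longrightarrow> j < n \<Longrightarrow> d i j = d j i"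
    and nonneg: "\<And>i j. i < n \<Longrightarrow> j < n \<Longrightarrow> 0 \<le> d i j"
    and pos: "\<And>i. i < n \<Longrightarrow> 0 < v i"
    and eigen: "\<And>i. i < n \<Longrightarrow> (\<Sum>j<n. d i j * v j) = ev * v i"
begin

text \<open>By symmetry \<open>v\<close> is also a left eigenvector.\<close>
lemma weighted_sum:
  "(\<Sum>i<n. v i * (\<Sum>j<n. d i j * y j)) = ev * (\<Sum>i<n. v i * y i)"
proof -
  have "(\<Sum>i<n. v i * (\<Sum>j<n. d i j * y j)) = (\<Sum>j<n. \<Sum>i<n. v i * (d i j * y j))"
    unfolding sum_distrib_left by (rule sum.swap)
  also have "\<dots> = (\<Sum>j<n. (\<Sum>i<n. d j i * v i) * y j)"
    unfolding sum_distrib_right using sym by (intro sum.cong) (auto simp: mult_ac)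
  also have "\<dots> = ev * (\<Sum>i<n. v i * y i)"
    unfolding sum_distrib_left using eigen by (intro sum.cong) (auto simp: mult_ac)
  finally show ?thesis .
qed

text \<open>Pair the inequality \<open>\<mu> y \<le> D y\<close> with \<open>v\<close>: the defects \<open>(D y - \<mu> y) i\<close>, weighted by the positive
  numbers \<open>v i\<close>, add up to \<open>(ev - \<mu>)\<close> times the positive pairing of \<open>v\<close> and \<open>y\<close>. So \<open>\<mu> \<le> ev\<close>, and
  for \<open>\<mu> = ev\<close> every defect vanishes.\<close>
lemma subinvariant:
  assumes "\<And>i. 0 \<le> y i" "\<exists>i<n. 0 < y i"
    and sub: "\<And>i. i < n \<Longrightarrow> \<mu> * y i \<le> (\<Sum>j<n. d i j * y j)"
  shows "\<mu> \<le> ev" "\<mu> = ev \<Longrightarrow> i < n \<Longrightarrow> (\<Sum>j<n. d i j * y j) = ev * y i"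
proof -
  let ?S = "\<Sum>i<n. v i * y i" and ?e = "\<lambda>i. v i * ((\<Sum>j<n. d i j * y j) - \<mu> * y i)"
  have S: "0 < ?S"
  proof -
    obtain i where "i < n" "0 < y i" using assms(2) by blast
    with pos assms(1) show ?thesis
      by (intro sum_pos2[of _ i]) (auto simp: less_imp_le)
  qed
  have e: "0 \<le> ?e i" if "i < n" for i using sub[OF that] pos[OF that] by simp
  have sum_e: "(\<Sum>i<n. ?e i) = (ev - \<mu>) * ?S"
    unfolding right_diff_distrib sum_subtractf weighted_sum left_diff_distrib
    by (simp add: sum_distrib_left mult_ac)
  have "0 \<le> (\<Sum>i<n. ?e i)" using e by (intro sum_nonneg) auto
  then show "\<mu> \<le> ev" using S unfolding sum_e by (simp add: zero_le_mult_iff)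
  assume "\<mu> = ev" and i: "i < n"
  then have "(\<Sum>i<n. ?e i) = 0" using sum_e by simp
  then have "?e i = 0" using e i by (subst (asm) sum_nonneg_eq_0_iff) auto
  with pos[OF i] \<open>\<mu> = ev\<close> show "(\<Sum>j<n. d i j * y j) = ev * y i" by simp
qed

lemma spectral_radius_eq: "spectral_radius (map_mat complex_of_real (mat n n (\<lambda>(i, j). d i j))) = ev"
proof -
  let ?D = "map_mat complex_of_real (mat n n (\<lambda>(i, j). d i j))"
  let ?x = "vec n (\<lambda>i. complex_of_real (v i))"
  have carrier: "?D \<in> carrier_mat n n" by simp
  have "0 \<le> ev"
  proof -
    have "0 \<le> (\<Sum>j<n. d 0 j * v j)" using n nonneg pos by (intro sum_nonneg) (auto simp: less_imp_le)
    with eigen[OF n] pos[OF n] show ?thesis by (simp add: zero_le_mult_iff)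
  qed
  have "?D *\<^sub>v ?x = complex_of_real ev \<cdot>\<^sub>v ?x"
  proof (rule eq_vecI)
    fix i assume "i < dim_vec (complex_of_real ev \<cdot>\<^sub>v ?x)"
    then have i: "i < n" by simp
    then have "(?D *\<^sub>v ?x) $ i = complex_of_real (\<Sum>j<n. d i j * v j)"
      by (simp add: scalar_prod_def atLeast0LessThan)
    then show "(?D *\<^sub>v ?x) $ i = (complex_of_real ev \<cdot>\<^sub>v ?x) $ i"
      using i eigen[OF i] by simp
  qed simp
  moreover have "?x \<noteq> 0\<^sub>v n"
  proof
    assume "?x = 0\<^sub>v n"
    then have "?x $ 0 = 0\<^sub>v n $ 0" by simp
    with n pos[OF n] show False by simp
  qed
  ultimately have "complex_of_real ev \<in> spectrum ?D"
    by (auto simp: spectrum_def eigenvalue_def eigenvector_def intro!: exI[of _ ?x])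
  then have "ev \<in> norm ` spectrum ?D"
    using \<open>0 \<le> ev\<close> by (intro image_eqI[of _ _ "complex_of_real ev"]) auto
  then have "ev \<le> spectral_radius ?D" by (rule spectral_radius_mem_max(2)[OF carrier n])
  moreover obtain k where "k \<in> spectrum ?D" "spectral_radius ?D = norm k"
    using spectral_radius_mem_max(1)[OF carrier n] by auto
  moreover from eigenvalue_abs_le_abs_kernel[OF nonneg this(1)]
  obtain y where "\<And>i. 0 \<le> y i" "\<exists>i<n. 0 < y i"
    "\<And>i. i < n \<Longrightarrow> norm k * y i \<le> (\<Sum>j<n. d i j * y j)" by blast
  then have "norm k \<le> ev" by (rule subinvariant(1))
  ultimately show ?thesis by simp
qed

text \<open>If an eigenvalue of the smaller kernel had absolute value \<open>ev\<close>, then the absolute values \<open>y\<close>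
  of its eigenvector would be an eigenvector of \<open>d\<close>. Such a \<open>y\<close> has no zero entry, because the
  off-diagonal entries are positive, and so the strict inequality at \<open>(p, q)\<close> is felt in row \<open>p\<close>.\<close>
lemma spectral_radius_less:
  assumes a: "\<And>i j. i < n \<Longrightarrow> j < n \<Longrightarrow> 0 \<le> a i j" "\<And>i j. i < n \<Longrightarrow> j < n \<Longrightarrow> a i j \<le> d i j"
    and strict: "p < n" "q < n" "a p q < d p q"
    and offdiag: "\<And>i j. i < n \<Longrightarrow> j < n \<Longrightarrow> i \<noteq> j \<Longrightarrow> 0 < d i j"
  shows "spectral_radius (map_mat complex_of_real (mat n n (\<lambda>(i, j). a i j))) < ev"
proof -
  let ?A = "map_mat complex_of_real (mat n n (\<lambda>(i, j). a i j))"
  have "?A \<in> carrier_mat n n" by simp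
  from spectral_radius_mem_max(1)[OF this n]
  obtain k where k: "k \<in> spectrum ?A" "spectral_radius ?A = norm k" by auto
  from eigenvalue_abs_le_abs_kernel[OF a(1) k(1)]
  obtain y where y: "\<And>i. 0 \<le> y i" "\<exists>i<n. 0 < y i"
    and sub: "\<And>i. i < n \<Longrightarrow> norm k * y i \<le> (\<Sum>j<n. a i j * y j)" by blast
  have le: "(\<Sum>j<n. a i j * y j) \<le> (\<Sum>j<n. d i j * y j)" if "i < n" for i
    using a y(1) that by (intro sum_mono mult_right_mono) auto
  have sub': "norm k * y i \<le> (\<Sum>j<n. d i j * y j)" if "i < n" for i
    using sub[OF that] le[OF that] by simp
  have "norm k \<noteq> ev"
  proof
    assume eq: "norm k = ev"
    have yd: "(\<Sum>j<n. d i j * y j) = ev * y i" if "i < n" for i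
      using subinvariant(2)[OF y sub' eq that] by simp
    have y_pos: "0 < y i" if i: "i < n" for i
    proof (rule ccontr)
      assume "\<not> 0 < y i"
      with y(1)[of i] have "y i = 0" by simp
      with y(2) obtain j where j: "j < n" "0 < y j" "j \<noteq> i" by force
      have "0 < (\<Sum>j<n. d i j * y j)"
        using i j offdiag nonneg y(1) by (intro sum_pos2[of _ j]) auto
      with yd[OF i] \<open>y i = 0\<close> show False by simp
    qed
    have "(\<Sum>j<n. a p j * y j) < (\<Sum>j<n. d p j * y j)"
      using a strict y_pos by (intro sum_strict_mono_ex1) (auto simp: less_imp_le mult_right_mono)
    with sub[OF strict(1)] yd[OF strict(1)] eq show False by simp
  qed
  moreover have "norm k \<le> ev" using y sub' by (rule subinvariant(1))
  ultimately show ?thesis using k(2) by simp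
qed

end

section \<open>The distance matrix of the path\<close>

text \<open>Summation by parts against \<open>\<bar>i - j\<bar>\<close>, on either side of the kink at \<open>j = i\<close>. The index of \<open>w\<close> is
  shifted by one, so that \<open>w 0\<close> and \<open>w (n + 1)\<close> are the values just outside the range of
  summation \<open>0, \<dots>, n - 1\<close>.\<close>
lemma second_difference_sum_left:
  fixes w :: "nat \<Rightarrow> real"
  shows "(\<Sum>j<i. (real i - real j) * (w (Suc (Suc j)) - 2 * w (Suc j) + w j))
    = w (Suc i) - w 1 - real i * (w 1 - w 0)"
proof (induction i)
  case (Suc i)
  let ?f = "\<lambda>j. w (Suc (Suc j)) - 2 * w (Suc j) + w j"
  have "(\<Sum>j<Suc i. (real (Suc i) - real j) * ?f j) = (\<Sum>j<Suc i. (real i - real j) * ?f j + ?f j)"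
    by (intro sum.cong) (auto simp: algebra_simps)
  also have "\<dots> = (\<Sum>j<i. (real i - real j) * ?f j) + (\<Sum>j<Suc i. ?f j)"
    by (simp add: sum.distrib)
  also have "(\<Sum>j<Suc i. ?f j) = w (Suc (Suc i)) - w (Suc i) - (w 1 - w 0)"
    by (induction i) auto
  finally have step: "(\<Sum>j<Suc i. (real (Suc i) - real j) * ?f j)
    = (\<Sum>j<i. (real i - real j) * ?f j) + (w (Suc (Suc i)) - w (Suc i) - (w 1 - w 0))" .
  show ?case unfolding step Suc.IH by (simp add: algebra_simps)
qed simp

lemma second_difference_sum_right:
  fixes w :: "nat \<Rightarrow> real"
  shows "(\<Sum>j=i..<i + m. (real j - real i) * (w (Suc (Suc j)) - 2 * w (Suc j) + w j))
    = (real m - 1) * (w (Suc (i + m)) - w (i + m)) - w (i + m) + w (Suc i)"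
  by (induction m) (auto simp: algebra_simps)

lemma abs_diff_sum_second_difference:
  fixes w :: "nat \<Rightarrow> real"
  assumes "i < n"
  shows "(\<Sum>j<n. \<bar>real i - real j\<bar> * (w (Suc (Suc j)) - 2 * w (Suc j) + w j))
    = 2 * w (Suc i) - w 1 - w n - real i * (w 1 - w 0) + (real n - real i - 1) * (w (Suc n) - w n)"
proof -
  let ?f = "\<lambda>j. w (Suc (Suc j)) - 2 * w (Suc j) + w j"
  have "(\<Sum>j<n. \<bar>real i - real j\<bar> * ?f j)
    = (\<Sum>j<i. \<bar>real i - real j\<bar> * ?f j) + (\<Sum>j=i..<n. \<bar>real i - real j\<bar> * ?f j)"
    unfolding lessThan_atLeast0 using assms by (intro sum.atLeastLessThan_concat[symmetric]) auto
  also have "(\<Sum>j<i. \<bar>real i - real j\<bar> * ?f j) = (\<Sum>j<i. (real i - real j) * ?f j)"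
    by (intro sum.cong) auto
  also have "(\<Sum>j=i..<n. \<bar>real i - real j\<bar> * ?f j) = (\<Sum>j=i..<n. (real j - real i) * ?f j)"
    by (intro sum.cong) auto
  finally show ?thesis
    using second_difference_sum_right[where i = i and m = "n - i" and w = w] assms
    by (simp add: second_difference_sum_left of_nat_diff)
qed

lemma perron_kernel_path:
  fixes t :: real
  assumes n: "0 < n" and t: "0 < t" and eq: "tanh (t / 2) * tanh (real n * t / 2) = 1 / real n"
  shows "perron_kernel n (\<lambda>i j. \<bar>real i - real j\<bar>)
    (\<lambda>i. cosh (t * (real i - (real n - 1) / 2))) (1 / (cosh t - 1))"
proof
  fix i assume i: "i < n"
  (* The same hyperbolic cosine, shifted by one index to include both values just outside the path. *)
  define w where "w j = cosh (t * (real j - (real n + 1) / 2))" for j :: nat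
  have w: "cosh (t * (real j - (real n - 1) / 2)) = w (Suc j)" for j
    by (simp add: w_def field_simps)
  have c: "cosh t > 1" using cosh_real_strict_mono[of 0 t] t by simp
  have rec: "w (Suc (Suc j)) - 2 * w (Suc j) + w j = 2 * (cosh t - 1) * w (Suc j)" for j
  proof -
    let ?x = "t * (real (Suc j) - (real n + 1) / 2)"
    have "t * (real (Suc (Suc j)) - (real n + 1) / 2) = ?x + t"
      "t * (real j - (real n + 1) / 2) = ?x - t" by (simp_all add: algebra_simps)
    then show ?thesis by (simp only: w_def cosh_add cosh_diff) (simp add: algebra_simps)
  qed
  have "w 1 = w n"
    unfolding w_def by (subst cosh_minus[symmetric]) (simp add: algebra_simps add_divide_distrib)
  have "w 0 = w (Suc n)"
    unfolding w_def by (subst cosh_minus[symmetric]) (simp add: algebra_simps add_divide_distrib)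
  let ?N = "real n * t / 2"
  have wn: "w n = cosh (?N - t / 2)" "w (Suc n) = cosh (?N + t / 2)"
    by (simp_all add: w_def algebra_simps add_divide_distrib diff_divide_distrib)
  (* The only use of the equation for t: it cancels the boundary terms of the summation by parts. *)
  have "real n * (sinh (t / 2) * sinh ?N) = cosh (t / 2) * cosh ?N"
    using eq n by (simp add: tanh_def field_simps)
  then have boundary: "(real n - 1) * (w (Suc n) - w n) = 2 * w n"
    unfolding wn cosh_add cosh_diff by (simp add: algebra_simps)
  have "2 * (cosh t - 1) * (\<Sum>j<n. \<bar>real i - real j\<bar> * w (Suc j))
    = (\<Sum>j<n. \<bar>real i - real j\<bar> * (w (Suc (Suc j)) - 2 * w (Suc j) + w j))"
    unfolding rec by (simp add: sum_distrib_left mult_ac)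
  also have "\<dots> = 2 * w (Suc i)"
    unfolding abs_diff_sum_second_difference[OF i] \<open>w 1 = w n\<close> \<open>w 0 = w (Suc n)\<close>
    using boundary by (simp add: algebra_simps)
  finally have "(cosh t - 1) * (\<Sum>j<n. \<bar>real i - real j\<bar> * w (Suc j)) = w (Suc i)"
    by (simp only: mult.assoc mult_cancel_left) simp
  then show "(\<Sum>j<n. \<bar>real i - real j\<bar> * cosh (t * (real j - (real n - 1) / 2)))
      = 1 / (cosh t - 1) * cosh (t * (real i - (real n - 1) / 2))"
    unfolding w using c t by (auto simp: eq_divide_eq mult.commute[of _ "cosh t - 1"])
qed (use n in auto)

text \<open>The left-hand side is 0 at \<open>t = 0\<close> and tends to 1, which exceeds \<open>1 / n\<close> as soon as
  \<open>n \<ge> 2\<close>.\<close>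
lemma exists_path_parameter:
  assumes "n \<ge> 2"
  shows "\<exists>t::real. 0 < t \<and> tanh (t / 2) * tanh (real n * t / 2) = 1 / real n"
proof -
  let ?f = "\<lambda>t::real. tanh (t / 2) * tanh (real n * t / 2)"
  have scale: "filterlim (\<lambda>t::real. c * t) at_top at_top" if "0 < c" for c
    using that by (intro filterlim_tendsto_pos_mult_at_top[OF tendsto_const _ filterlim_ident])
  have 1: "filterlim (\<lambda>t::real. t / 2) at_top at_top"
    using scale[of "1 / 2"] by simp
  have 2: "filterlim (\<lambda>t::real. real n * t / 2) at_top at_top"
    using scale[of "real n / 2"] assms by simp
  have "(?f \<longlongrightarrow> 1 * 1) at_top"
    by (intro tendsto_mult filterlim_compose[OF tanh_real_at_top] 1 2)
  moreover have "1 / real n < 1 * 1" using assms by simp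
  ultimately have "eventually (\<lambda>t. 1 / real n < ?f t) at_top" by (rule order_tendstoD)
  then have "eventually (\<lambda>t. 1 / real n < ?f t \<and> 0 < t) at_top"
    using eventually_gt_at_top by (rule eventually_conj)
  then obtain b where b: "1 / real n < ?f b" "0 < b"
    by (auto dest: eventually_happens)
  have "\<exists>t\<ge>0. t \<le> b \<and> ?f t = 1 / real n"
    using b by (intro IVT') (auto intro!: continuous_intros)
  then obtain t where "0 \<le> t" "?f t = 1 / real n" by blast
  moreover from this assms have "t \<noteq> 0" by auto
  ultimately show ?thesis by (intro exI[of _ t]) auto
qed

section \<open>Levels\<close>

lemma (in pair_wf_digraph) potential_le_awalk:
  fixes f :: "'a \<Rightarrow> nat"
  assumes "\<And>u v. (u, v) \<in> parcs G \<Longrightarrow> f v \<le> Suc (f u)" and "awalk u p v"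
  shows "f v \<le> f u + length p"
  using assms(2)
proof (induction p arbitrary: u)
  case Nil
  then show ?case by (simp add: awalk_Nil_iff)
next
  case (Cons e p)
  then have "e \<in> parcs G" "fst e = u" "awalk (snd e) p v" by (auto simp: awalk_Cons_iff)
  with Cons.IH[of "snd e"] assms(1)[of u "snd e"] show ?case by force
qed

text \<open>The level is characterised by three local conditions: it vanishes at the root only, it grows by at
  most one along an arc (so no walk is too short), and every other vertex has a predecessor
  one level lower (so following predecessors yields a walk of the right length).\<close>
lemma (in pair_wf_digraph) level_eqI:
  assumes r: "r \<in> pverts G"
    and root: "\<And>v. v \<in> pverts G \<Longrightarrow> f v = 0 \<longleftrightarrow> v = r"
    and arc: "\<And>u v. (u, v) \<in> parcs G \<Longrightarrow> f v \<le> Suc (f u)"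
    and pred: "\<And>v. v \<in> pverts G \<Longrightarrow> 0 < f v \<Longrightarrow> \<exists>u. (u, v) \<in> parcs G \<and> f v = Suc (f u)"
    and v: "v \<in> pverts G"
  shows "level G r v = f v"
proof -
  have "\<exists>p. awalk r p v \<and> length p = k" if "f v = k" for k
    using that v
  proof (induction k arbitrary: v)
    case 0
    with root r show ?case by (auto simp: awalk_Nil_iff)
  next
    case (Suc k)
    then obtain u where u: "(u, v) \<in> parcs G" "f u = k" using pred[of v] by auto
    with Suc.IH[of u] obtain p where p: "awalk r p u" "length p = k"
      by (auto dest: in_arcsD1)
    then have "awalk r (p @ [(u, v)]) v"
      using u by (auto simp: awalk_Cons_iff awalk_Nil_iff dest: in_arcsD2)
    with p show ?case by (intro exI[of _ "p @ [(u, v)]"]) simp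
  qed
  moreover have "f v \<le> length p" if "awalk r p v" for p
    using potential_le_awalk[of f r p v, OF arc that] root[OF r] by simp
  ultimately show ?thesis
    unfolding level_def by (intro Least_equality) auto
qed

locale connected_pair_graph = pair_graph +
  fixes r :: 'a
  assumes conn: "Digraph_Component.connected (with_proj G)" and r: "r \<in> pverts G"
begin

lemma awalk_of_level_length:
  assumes "v \<in> pverts G"
  obtains p where "awalk r p v" "length p = level G r v"
proof -
  have "strongly_connected (with_proj G)"
    using symmetric_connected_imp_strongly_connected[OF _ conn] pair_sym_arcs by blast
  then have "r \<rightarrow>\<^sup>*\<^bsub>with_proj G\<^esub> v" using r assms by auto
  then have "\<exists>k p. awalk r p v \<and> length p = k" by (auto simp: reachable_awalk)
  then have "\<exists>p. awalk r p v \<and> length p = level G r v"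
    unfolding level_def by (rule LeastI_ex)
  with that show ?thesis by blast
qed

lemma level_le: "awalk r p v \<Longrightarrow> level G r v \<le> length p"
  unfolding level_def by (intro Least_le) auto

lemma level_root: "level G r r = 0"
  using level_le[of "[]" r] r by (simp add: awalk_Nil_iff)

lemma level_arc:
  assumes "(u, v) \<in> parcs G"
  shows "level G r v \<le> Suc (level G r u)"
proof -
  obtain p where p: "awalk r p u" "length p = level G r u"
    using awalk_of_level_length assms in_arcsD1 by blast
  then have "awalk r (p @ [(u, v)]) v"
    using assms by (auto simp: awalk_Cons_iff awalk_Nil_iff dest: in_arcsD2)
  from level_le[OF this] p show ?thesis by simp
qed

lemma level_pred:
  assumes "v \<in> pverts G" "level G r v = Suc k"
  obtains u where "(u, v) \<in> parcs G" "level G r u = k"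
proof -
  obtain p where p: "awalk r p v" "length p = Suc k"
    using awalk_of_level_length assms by metis
  then obtain q a where q: "p = q @ [a]" by (cases p rule: rev_cases) auto
  with p have "awalk r q (fst a)" "a \<in> parcs G" "snd a = v"
    by (auto simp: awalk_Cons_iff awalk_Nil_iff)
  then have a: "(fst a, v) \<in> parcs G" by auto
  have "level G r (fst a) \<le> k" using level_le[OF \<open>awalk r q (fst a)\<close>] p q by simp
  with level_arc[OF a] assms(2) have "level G r (fst a) = k" by simp
  with a that show ?thesis by blast
qed

text \<open>No level is skipped: a vertex at level \<open>k + 1\<close> has a neighbour at level \<open>k\<close>, which comes
  earlier in the sorted list.\<close>
lemma sorted_enumeration:
  obtains vs where "distinct vs" "set vs = pverts G"
    "level G r (vs ! 0) = 0"
    "\<And>i j. i \<le> j \<Longrightarrow> j < length vs \<Longrightarrow> level G r (vs ! i) \<le> level G r (vs ! j)"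
    "\<And>i. Suc i < length vs \<Longrightarrow> level G r (vs ! Suc i) \<le> Suc (level G r (vs ! i))"
proof -
  let ?l = "level G r"
  obtain ws where ws: "set ws = pverts G" "distinct ws"
    using finite_distinct_list pair_finite_verts by blast
  define vs where "vs = sort_key ?l ws"
  have vs: "distinct vs" "set vs = pverts G" using ws by (auto simp: vs_def)
  have "sorted (map ?l vs)" by (simp add: vs_def)
  then have mono: "?l (vs ! i) \<le> ?l (vs ! j)" if "i \<le> j" "j < length vs" for i j
    using that sorted_nth_mono[of "map ?l vs" i j] by simp
  have "?l (vs ! 0) = 0"
  proof -
    obtain i where "i < length vs" "vs ! i = r" using vs r by (metis in_set_conv_nth)
    with mono[of 0 i] level_root show ?thesis by simp
  qed
  moreover have "?l (vs ! Suc i) \<le> Suc (?l (vs ! i))" if i: "Suc i < length vs" for i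
  proof (rule ccontr)
    assume gap: "\<not> ?thesis"
    then obtain k where k: "?l (vs ! Suc i) = Suc k" by (cases "?l (vs ! Suc i)") auto
    have "vs ! Suc i \<in> pverts G" using vs i nth_mem by blast
    then obtain u where "(u, vs ! Suc i) \<in> parcs G" "?l u = k"
      using k by (rule level_pred)
    moreover from this obtain j where "j < length vs" "vs ! j = u"
      using vs by (metis in_arcsD1 in_set_conv_nth)
    ultimately show False
      using mono[of j i] mono[of "Suc i" j] gap k i by (cases "j \<le> i") auto
  qed
  ultimately show ?thesis using that vs mono by blast
qed

end

lemma rooted_tree_connected_pair_graph:
  "rooted_tree T r \<Longrightarrow> connected_pair_graph T r"
  by (simp add: rooted_tree_def undirected_tree_def connected_pair_graph_def
      connected_pair_graph_axioms_def)

section \<open>The path\<close>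

lemma pverts_path_graph: "pverts (path_graph n) = {..<n}"
  by (simp add: path_graph_def)
lemma pair_graph_path: "pair_graph (path_graph n)"
proof
  show "finite (parcs (path_graph n))"
    by (rule finite_subset[of _ "{..<n} \<times> {..<n}"]) (auto simp: path_graph_def)
  show "symmetric (with_proj (path_graph n))"
    by (auto simp: symmetric_def path_graph_def intro: symI)
qed (auto simp: path_graph_def)

interpretation path: pair_graph "path_graph n" for n
  by (rule pair_graph_path)

lemma connected_path:
  assumes "n \<ge> 1"
  shows "Digraph_Component.connected (with_proj (path_graph n))"
proof -
  let ?V = "{..<n}" and ?R = "(parcs (path_graph n))\<^sup>s"
  have from_0: "i < n \<Longrightarrow> (0, i) \<in> rtrancl_on ?V ?R" for i
  proof (induction i)
    case (Suc i)
    then have "(0, i) \<in> rtrancl_on ?V ?R" "(i, Suc i) \<in> ?R" "Suc i \<in> ?V"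
      by (auto simp: symcl_def path_graph_def)
    then show ?case by (rule rtrancl_on_into_rtrancl_on)
  qed (use assms in auto)
  have to_0: "i < n \<Longrightarrow> (i, 0) \<in> rtrancl_on ?V ?R" for i
  proof (induction i)
    case (Suc i)
    then have "(i, 0) \<in> rtrancl_on ?V ?R" "(Suc i, i) \<in> ?R" "Suc i \<in> ?V"
      by (auto simp: symcl_def path_graph_def)
    then show ?case by (meson converse_rtrancl_on_into_rtrancl_on)
  qed (use assms in auto)
  have "(i, j) \<in> rtrancl_on ?V ?R" if "i < n" "j < n" for i j
    using to_0[OF that(1)] from_0[OF that(2)] by (rule rtrancl_on_trans)
  with assms show ?thesis by (auto simp: connected_conv path_graph_def lessThan_empty_iff)
qed

text \<open>Both cyclic neighbours of the index where \<open>x\<close> is largest carry the value one below the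
  maximum; for \<open>k \<ge> 3\<close> these are two different indices.\<close>
lemma no_injective_cyclic_unit_steps:
  fixes x :: "nat \<Rightarrow> nat"
  assumes k: "k \<ge> 3"
    and inj: "inj_on x {..<k}"
    and step: "\<And>i. i < k \<Longrightarrow> x (Suc i mod k) = Suc (x i) \<or> x i = Suc (x (Suc i mod k))"
  shows False
proof -
  have "finite (x ` {..<k})" "x ` {..<k} \<noteq> {}" using k by (auto simp: lessThan_empty_iff)
  then have "Max (x ` {..<k}) \<in> x ` {..<k}" by (rule Max_in)
  then obtain m where m: "m < k" "Max (x ` {..<k}) = x m" by auto
  then have max: "x i \<le> x m" if "i < k" for i
    using that Max_ge[of "x ` {..<k}" "x i"] by simp
  define s where "s = Suc m mod k"
  (* The cyclic predecessor of m; m - 1 would truncate at m = 0. *)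
  define p where "p = (m + (k - 1)) mod k"
  have sp: "s < k" "p < k" using k by (auto simp: s_def p_def)
  have "Suc p mod k = m"
    using m k by (simp add: p_def mod_Suc_eq)
  then have "x m = Suc (x p)" using step[OF sp(2)] max[OF sp(2)] by auto
  moreover have "x m = Suc (x s)" using step[OF m(1)] max[OF sp(1)] by (auto simp: s_def)
  ultimately have "s = p" using inj sp by (auto dest: inj_onD)
  then show False
    using m k unfolding s_def p_def
    by (cases "m = 0"; cases "Suc m = k") (auto simp: mod_if split: if_splits)
qed

lemma no_long_cycle_path:
  assumes "pre_digraph.cycle (with_proj (path_graph n)) p"
  shows "length p < 3"
proof (rule ccontr)
  assume long: "\<not> length p < 3"
  from assms obtain u where u: "path.awalk n u p u" and d: "distinct (tl (pawalk_verts u p))"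
    by (auto simp: pre_digraph.cycle_def)
  let ?k = "length p" and ?xs = "pawalk_verts u p"
  have ne: "p \<noteq> []" and arcs: "set p \<subseteq> parcs (path_graph n)" and "pcas u p u"
    using long u by (auto simp: pre_digraph.awalk_def)
  have tails: "?xs = map fst p @ [snd (last p)]"
    using ne path.awalk_verts_conv[of u p] by auto
  have heads: "?xs = fst (hd p) # map snd p"
    using ne path.awalk_verts_conv'[OF \<open>pcas u p u\<close>] by auto
  have "last ?xs = hd ?xs"
    using path.awlast_if_cas[OF \<open>pcas u p u\<close>] path.awhd_if_cas[OF \<open>pcas u p u\<close>] by simp
  then have closed: "fst (hd p) = snd (last p)"
    using ne by (subst (asm) (1) tails, subst (asm) heads) simp
  (* Consecutive arcs meet, cyclically: compare the two ways to read off the vertices of the walk. *)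
  have next_tail: "fst (p ! (Suc i mod ?k)) = snd (p ! i)" if i: "i < ?k" for i
  proof (cases "Suc i = ?k")
    case True
    then have "i = ?k - 1" by simp
    with closed ne True show ?thesis by (simp add: hd_conv_nth last_conv_nth)
  next
    case False
    with i have "Suc i < ?k" by simp
    then have "?xs ! Suc i = fst (p ! Suc i)" by (subst tails) (simp add: nth_append)
    moreover have "?xs ! Suc i = snd (p ! i)" using i by (subst heads) simp
    ultimately show ?thesis using \<open>Suc i < ?k\<close> by simp
  qed
  have "distinct (map snd p)" using d heads by simp
  then have "inj_on (\<lambda>i. snd (p ! i)) {..<?k}"
    by (auto simp: inj_on_def distinct_conv_nth)
  moreover have "snd (p ! (Suc i mod ?k)) = Suc (snd (p ! i)) \<or>
      snd (p ! i) = Suc (snd (p ! (Suc i mod ?k)))" if "i < ?k" for i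
  proof -
    have "p ! (Suc i mod ?k) \<in> parcs (path_graph n)" using arcs ne nth_mem by fastforce
    then show ?thesis using next_tail[OF that] by (auto simp: path_graph_def)
  qed
  ultimately show False
    using no_injective_cyclic_unit_steps[of ?k "\<lambda>i. snd (p ! i)"] long by simp
qed

lemma rooted_tree_path:
  assumes "n \<ge> 1"
  shows "rooted_tree (path_graph n) 0"
  unfolding rooted_tree_def undirected_tree_def
  using assms pair_graph_path connected_path no_long_cycle_path
  by (auto simp: path_graph_def not_le[symmetric])

lemma level_path:
  assumes "i < n"
  shows "level (path_graph n) 0 i = i"
proof (rule path.level_eqI)
  fix v assume "v \<in> pverts (path_graph n)" "0 < v"
  then show "\<exists>u. (u, v) \<in> parcs (path_graph n) \<and> v = Suc u"
    by (intro exI[of _ "v - 1"]) (auto simp: path_graph_def)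
qed (use assms in \<open>auto simp: path_graph_def\<close>)

text \<open>An isomorphism onto the path satisfies the three conditions that characterise the level, hence
  coincides with it.\<close>
lemma rooted_iso_path_level:
  assumes "pair_wf_digraph T" "r \<in> pverts T" and n: "n \<ge> 1"
    and "rooted_iso T r (path_graph n) 0"
  shows "bij_betw (level T r) (pverts T) {..<n}"
proof -
  interpret T: pair_wf_digraph T by fact
  obtain h where bij: "bij_betw h (pverts T) {..<n}" and hr: "h r = 0"
    and arcs: "\<And>u v. u \<in> pverts T \<Longrightarrow> v \<in> pverts T \<Longrightarrow>
      (u, v) \<in> parcs T \<longleftrightarrow> (h u, h v) \<in> parcs (path_graph n)"
    using rooted_iso_iff_bij[OF assms(1) path.pair_wf_digraph_axioms] assms(4)
    by (auto simp: path_graph_def)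
  have inj: "inj_on h (pverts T)" and img: "h ` pverts T = {..<n}"
    using bij by (auto simp: bij_betw_def)
  have "level T r v = h v" if "v \<in> pverts T" for v
  proof (rule T.level_eqI[OF assms(2) _ _ _ that])
    show "h v = 0 \<longleftrightarrow> v = r" if "v \<in> pverts T" for v
      using inj_onD[OF inj, of v r] hr that assms(2) by auto
    show "h v \<le> Suc (h u)" if "(u, v) \<in> parcs T" for u v
      using that arcs[of u v] T.in_arcsD1[OF that] T.in_arcsD2[OF that]
      by (auto simp: path_graph_def)
    show "\<exists>u. (u, v) \<in> parcs T \<and> h v = Suc (h u)" if v: "v \<in> pverts T" "0 < h v" for v
    proof -
      have hv: "h v < n" using v img by auto
      then have "h v - 1 \<in> h ` pverts T" using img by auto
      then obtain u where "u \<in> pverts T" "h u = h v - 1" by (metis imageE)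
      with v hv arcs[of u v] show ?thesis by (auto simp: path_graph_def)
    qed
  qed
  with bij show ?thesis by (simp cong: bij_betw_cong)
qed

text \<open>When each level has a single vertex, the neighbour one level below a vertex is
  \<^emph>\<open>the\<close> vertex of that level, so all consecutive levels are joined; and there are no further
  arcs, since an arc joins distinct vertices and changes the level by at most one.\<close>
lemma (in connected_pair_graph) bij_level_rooted_iso_path:
  assumes bij: "bij_betw (level G r) (pverts G) {..<n}"
  shows "rooted_iso G r (path_graph n) 0"
proof -
  let ?l = "level G r"
  have inj: "inj_on ?l (pverts G)" and img: "?l ` pverts G = {..<n}"
    using bij by (auto simp: bij_betw_def)
  have next_arc: "(u, v) \<in> parcs G"
    if u: "u \<in> pverts G" and v: "v \<in> pverts G" "?l v = Suc (?l u)" for u v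
  proof -
    obtain w where "(w, v) \<in> parcs G" "?l w = ?l u" using level_pred[OF v] .
    with inj u show ?thesis by (metis in_arcsD1 inj_onD)
  qed
  have "(u, v) \<in> parcs G \<longleftrightarrow> (?l u, ?l v) \<in> parcs (path_graph n)"
    if uv: "u \<in> pverts G" "v \<in> pverts G" for u v
  proof
    assume a: "(u, v) \<in> parcs G"
    then have "(v, u) \<in> parcs G" by (rule arcs_symmetric)
    with a have "?l v \<le> Suc (?l u)" "?l u \<le> Suc (?l v)" by (auto intro: level_arc)
    moreover have "?l u \<noteq> ?l v" using inj uv pair_no_loops[OF a] by (auto dest: inj_onD)
    ultimately show "(?l u, ?l v) \<in> parcs (path_graph n)"
      using uv img by (auto simp: path_graph_def)
  next
    assume "(?l u, ?l v) \<in> parcs (path_graph n)"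
    then have "?l v = Suc (?l u) \<or> ?l u = Suc (?l v)" by (auto simp: path_graph_def)
    with next_arc uv arcs_symmetric show "(u, v) \<in> parcs G" by blast
  qed
  then show ?thesis
    using bij level_root
    by (subst rooted_iso_iff_bij[OF pair_wf_digraph_axioms path.pair_wf_digraph_axioms])
      (auto simp: path_graph_def intro!: exI[of _ ?l])
qed

section \<open>Comparison with the path\<close>

lemma level_spectral_radius_bij_level:
  assumes bij: "bij_betw (level G r) (pverts G) {..<n}"
  shows "level_spectral_radius G r
    = spectral_radius (map_mat complex_of_real (mat n n (\<lambda>(i, j). \<bar>real i - real j\<bar>)))"
proof -
  let ?g = "inv_into (pverts G) (level G r)"
  define vs where "vs = map ?g [0..<n]"
  have g: "bij_betw ?g {..<n} (pverts G)" using bij by (rule bij_betw_inv_into)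
  then have "distinct vs" "set vs = pverts G"
    by (auto simp: vs_def distinct_map bij_betw_def atLeast0LessThan)
  moreover have "level G r (vs ! i) = i" if "i < n" for i
    using bij that by (simp add: vs_def bij_betw_inv_into_right)
  then have "level_matrix G r vs = mat n n (\<lambda>(i, j). \<bar>real i - real j\<bar>)"
    unfolding level_matrix_def by (intro eq_matI) (auto simp: vs_def)
  ultimately show ?thesis by (simp add: level_spectral_radius_eq)
qed

lemma level_spectral_radius_path:
  "level_spectral_radius (path_graph n) 0
    = spectral_radius (map_mat complex_of_real (mat n n (\<lambda>(i, j). \<bar>real i - real j\<bar>)))"
proof (rule level_spectral_radius_bij_level)
  have "bij_betw id {..<n} {..<n}" by simp
  then show "bij_betw (level (path_graph n) 0) (pverts (path_graph n)) {..<n}"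
    by (subst bij_betw_cong[of _ _ id]) (simp_all add: level_path pverts_path_graph)
qed

text \<open>In the sorted numbering the level matrix is dominated by that of the path. If levels are not in
  bijection with \<open>{..<n}\<close>, some vertex in position \<open>q\<close> has level below \<open>q\<close>, and the entry \<open>(0, q)\<close>
  is strictly smaller.\<close>
lemma (in connected_pair_graph) level_spectral_radius_less_path:
  assumes card: "card (pverts G) = n" and not_bij: "\<not> bij_betw (level G r) (pverts G) {..<n}"
  shows "level_spectral_radius G r < level_spectral_radius (path_graph n) 0"
proof -
  obtain vs where vs: "distinct vs" "set vs = pverts G" and zero: "level G r (vs ! 0) = 0"
    and mono: "\<And>i j. i \<le> j \<Longrightarrow> j < length vs \<Longrightarrow> level G r (vs ! i) \<le> level G r (vs ! j)"
    and gap: "\<And>i. Suc i < length vs \<Longrightarrow> level G r (vs ! Suc i) \<le> Suc (level G r (vs ! i))"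
    using sorted_enumeration by blast
  have len: "length vs = n" using vs card by (metis distinct_card)
  define l where "l i = level G r (vs ! i)" for i
  have steps: "l j \<le> l i + (j - i)" if "i \<le> j" "j < n" for i j
    using that
  proof (induction j rule: dec_induct)
    case (step j)
    then show ?case using gap[of j] len by (simp add: l_def)
  qed simp
  have le: "\<bar>real (l i) - real (l j)\<bar> \<le> \<bar>real i - real j\<bar>" if "i < n" "j < n" for i j
  proof (cases "i \<le> j")
    case True
    with that steps[of i j] mono[of i j] len show ?thesis by (simp add: l_def)
  next
    case False
    with that steps[of j i] mono[of j i] len show ?thesis by (simp add: l_def)
  qed
  have "\<exists>q<n. l q \<noteq> q"
  proof (rule ccontr)
    assume "\<not> ?thesis"
    then have l: "l i = i" if "i < n" for i using that by simp
    have "bij_betw ((!) vs) {..<n} (pverts G)"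
      using bij_betw_nth[OF vs(1)] vs(2) len by simp
    moreover have "bij_betw (level G r \<circ> (!) vs) {..<n} {..<n}"
      using l by (subst bij_betw_cong[of _ _ id]) (auto simp: l_def)
    ultimately show False
      using not_bij bij_betw_comp_iff by blast
  qed
  then obtain q where q: "q < n" "l q \<noteq> q" by blast
  have "l 0 = 0" using zero by (simp add: l_def)
  with q steps[of 0 q] have "l q < q" by simp
  with q have "n \<ge> 2" by simp
  then obtain t :: real where t: "0 < t" "tanh (t / 2) * tanh (real n * t / 2) = 1 / real n"
    using exists_path_parameter by blast
  from \<open>n \<ge> 2\<close> t interpret perron_kernel n "\<lambda>i j. \<bar>real i - real j\<bar>"
    "\<lambda>i. cosh (t * (real i - (real n - 1) / 2))" "1 / (cosh t - 1)"
    by (intro perron_kernel_path) auto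
  have "level_matrix G r vs = mat n n (\<lambda>(i, j). \<bar>real (l i) - real (l j)\<bar>)"
    by (simp add: level_matrix_def len l_def)
  then have "level_spectral_radius G r
      = spectral_radius (map_mat complex_of_real (mat n n (\<lambda>(i, j). \<bar>real (l i) - real (l j)\<bar>)))"
    using level_spectral_radius_eq[OF vs] by simp
  also have "\<dots> < 1 / (cosh t - 1)"
    using le q \<open>l q < q\<close> \<open>l 0 = 0\<close>
    by (intro spectral_radius_less[where p = 0 and q = q]) auto
  finally show ?thesis by (simp add: level_spectral_radius_path spectral_radius_eq)
qed

theorem theorem6:
  fixes n :: nat
  assumes "n \<ge> 1"
  shows "(rooted_tree (path_graph n) 0 \<and> card (pverts (path_graph n)) = n)
    \<and> (\<forall>(T :: 'a pair_pre_digraph) r. rooted_tree T r \<and> card (pverts T) = n \<longrightarrow>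
          level_spectral_radius T r \<le> level_spectral_radius (path_graph n) 0
          \<and> (level_spectral_radius T r = level_spectral_radius (path_graph n) 0
               \<longleftrightarrow> rooted_iso T r (path_graph n) 0))
    \<and> (n \<ge> 2 \<longrightarrow>
          (\<exists>t::real. t > 0 \<and> tanh (t / 2) * tanh (real n * t / 2) = 1 / real n)
          \<and> (\<forall>t::real. t > 0 \<and> tanh (t / 2) * tanh (real n * t / 2) = 1 / real n
               \<longrightarrow> level_spectral_radius (path_graph n) 0 = 1 / (cosh t - 1)))"
proof (intro conjI allI impI)
  show "rooted_tree (path_graph n) 0" using assms by (rule rooted_tree_path)
  show "card (pverts (path_graph n)) = n" by (simp add: path_graph_def)
next
  fix T :: "'a pair_pre_digraph" and r
  assume T: "rooted_tree T r \<and> card (pverts T) = n"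
  then interpret connected_pair_graph T r
    by (intro rooted_tree_connected_pair_graph) auto
  let ?bij = "bij_betw (level T r) (pverts T) {..<n}"
  have iso: "rooted_iso T r (path_graph n) 0 \<longleftrightarrow> ?bij"
    using rooted_iso_path_level[OF pair_wf_digraph_axioms r assms] bij_level_rooted_iso_path
    by blast
  have eq: "level_spectral_radius T r = level_spectral_radius (path_graph n) 0" if ?bij
    using level_spectral_radius_bij_level[OF that] by (simp add: level_spectral_radius_path)
  have less: "level_spectral_radius T r < level_spectral_radius (path_graph n) 0" if "\<not> ?bij"
    using T that by (intro level_spectral_radius_less_path) auto
  show "level_spectral_radius T r \<le> level_spectral_radius (path_graph n) 0"
    using eq less by (cases ?bij) auto
  show "level_spectral_radius T r = level_spectral_radius (path_graph n) 0
      \<longleftrightarrow> rooted_iso T r (path_graph n) 0"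
    unfolding iso using eq less by (cases ?bij) auto
next
  assume "n \<ge> 2"
  then show "\<exists>t::real. t > 0 \<and> tanh (t / 2) * tanh (real n * t / 2) = 1 / real n"
    by (rule exists_path_parameter)
next
  fix t :: real
  assume "t > 0 \<and> tanh (t / 2) * tanh (real n * t / 2) = 1 / real n"
  with assms interpret perron_kernel n "\<lambda>i j. \<bar>real i - real j\<bar>"
    "\<lambda>i. cosh (t * (real i - (real n - 1) / 2))" "1 / (cosh t - 1)"
    by (intro perron_kernel_path) auto
  show "level_spectral_radius (path_graph n) 0 = 1 / (cosh t - 1)"
    by (simp add: level_spectral_radius_path spectral_radius_eq)
qed

end
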